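(* Let $X$ be an arbitrary nonzero real Banach space. Then $\delta_X^+(\varepsilon)\asymp\rho_X(\varepsilon)$ as $\varepsilon \to 0$, and the following inequalities hold: $$\frac{1}{2}\,\rho_X\left(\frac{r}{6}\right) \le \delta_X^+(r) \le \rho_X(r), \quad r \in \left[0,\tfrac{1}{2}\right].$$
   Context: For a real Banach space $X$ with unit sphere $S_X=\{x\in X:\|x\|=1\}$: The Bana\'s modulus is $\delta_X^+(\varepsilon)=\sup\{1-\frac{\|x+y\|}{2}:\ x,y\in S_X,\ \|x-y\|\le\varepsilon\}$, $\varepsilon\in[0,2]$. The modulus of smoothness is $\rho_X(\tau)=\sup\{\frac{\|x+y\|}{2}+\frac{\|x-y\|}{2}-1:\ \|x\|=1,\ \|y\|=\tau\}$, $\tau\ge0$. Two non-negative functions $f,g$, each defined on a segment with left endpoint $0$, are equivalent at zero, written $f(t)\asymp g(t)$ as $t\to0$, if there are positive constants $a,b,c,d,e$ such that $a f(bt)\le g(t)\le c f(dt)$ for all $t\in[0,e]$. *)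

theory Defs
  imports "HOL-Analysis.Analysis"
begin

text \<open>The space is the type \<open>'a\<close>, passed as an argument of type \<open>'a itself\<close>. If the space is
  nonzero, the sets below are nonempty for \<open>\<epsilon> \<ge> 0\<close> and \<open>\<tau> \<ge> 0\<close>, and they are always bounded above,
  so that \<open>Sup\<close> is the actual supremum.\<close>

definition banas_modulus :: "'a::real_normed_vector itself \<Rightarrow> real \<Rightarrow> real" where
  "banas_modulus _ \<epsilon> =
     Sup {1 - norm (x + y) / 2 | x y :: 'a.
            x \<in> sphere 0 1 \<and> y \<in> sphere 0 1 \<and> norm (x - y) \<le> \<epsilon>}"

definition smoothness_modulus :: "'a::real_normed_vector itself \<Rightarrow> real \<Rightarrow> real" where
  "smoothness_modulus _ \<tau> =
     Sup {norm (x + y) / 2 + norm (x - y) / 2 - 1 | x y :: 'a. norm x = 1 \<and> norm y = \<tau>}"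

text \<open>\<open>D\<close> and \<open>E\<close> are the domains of \<open>f\<close> and \<open>g\<close>. The existential demands that every
  evaluation on \<open>{0..e}\<close> stays inside these domains.\<close>

definition equiv_at_zero ::
    "real set \<Rightarrow> (real \<Rightarrow> real) \<Rightarrow> real set \<Rightarrow> (real \<Rightarrow> real) \<Rightarrow> bool" where
  "equiv_at_zero D f E g \<longleftrightarrow>
     (\<forall>t\<in>D. 0 \<le> f t) \<and> (\<forall>t\<in>E. 0 \<le> g t) \<and>
     (\<exists>a>0. \<exists>b>0. \<exists>c>0. \<exists>d>0. \<exists>e>0. \<forall>t\<in>{0..e}.
        b * t \<in> D \<and> d * t \<in> D \<and> t \<in> E \<and>
        a * f (b * t) \<le> g t \<and> g t \<le> c * f (d * t))"

end

theory Submission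
  imports Defs
begin

text \<open>
  Both inequalities compare the same picture at two normalisations. If \<open>norm (x + y)\<close> and
  \<open>norm (x - y)\<close> have a common value \<open>s\<close> and \<open>norm x = 1\<close>, then \<open>(x + y) / s\<close> and \<open>(x - y) / s\<close>
  are unit vectors whose midpoint \<open>x / s\<close> has norm \<open>1 / s\<close>. The pair \<open>x, y\<close> contributes
  \<open>s - 1\<close> to the modulus of smoothness, and the two unit vectors contribute \<open>1 - 1 / s\<close> to the
  modulus of Banas. For small \<open>y\<close> these numbers are comparable.

  Every pair of unit vectors with nonzero midpoint arises in this way, by rescaling the midpoint to
  norm one; this gives \<open>banas_le_smoothness\<close>. Conversely, a small perturbation \<open>y\<close> of \<open>x\<close> need not be balanced.
  The intermediate value theorem provides a multiple \<open>c x\<close>, with \<open>\<bar>c\<bar> \<le> norm y\<close>, whose removal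
  from \<open>y\<close> makes it so (\<open>balanced_perturbation\<close>). Adding \<open>c x\<close> back only rescales \<open>x\<close> by the
  factor \<open>1 + c\<close> in \<open>x + y\<close> and \<open>1 - c\<close> in \<open>x - y\<close>, so the first-order effects of \<open>c\<close> cancel
  in the sum of the norms. To see this with the triangle inequality alone, one balances the larger
  perturbation \<open>Y = (3 / 2) y\<close>. Together with the bound \<open>norm (Y - c x) \<le> 2 norm Y\<close> this accounts
  for the constant \<open>6 = 2 \<cdot> 3 / 2 \<cdot> 2\<close>, the last factor because the two unit vectors differ by
  twice the perturbation (\<open>smoothness_le_banas\<close>).
\<close>

section \<open>The moduli as suprema\<close>

lemma banas_modulus_upper:
  fixes x y :: "'a::real_normed_vector"
  assumes "norm x = 1" "norm y = 1" "norm (x - y) \<le> \<epsilon>"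
  shows "1 - norm (x + y) / 2 \<le> banas_modulus TYPE('a) \<epsilon>"
  unfolding banas_modulus_def
proof (rule cSup_upper)
  show "1 - norm (x + y) / 2 \<in> {1 - norm (x + y) / 2 | x y :: 'a.
      x \<in> sphere 0 1 \<and> y \<in> sphere 0 1 \<and> norm (x - y) \<le> \<epsilon>}"
    using assms by auto
  show "bdd_above {1 - norm (x + y) / 2 | x y :: 'a.
      x \<in> sphere 0 1 \<and> y \<in> sphere 0 1 \<and> norm (x - y) \<le> \<epsilon>}"
    by (rule bdd_aboveI[of _ 1]) auto
qed

lemma smoothness_modulus_upper:
  fixes x y :: "'a::real_normed_vector"
  assumes "norm x = 1" "norm y = \<tau>"
  shows "norm (x + y) / 2 + norm (x - y) / 2 - 1 \<le> smoothness_modulus TYPE('a) \<tau>"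
  unfolding smoothness_modulus_def
proof (rule cSup_upper)
  show "norm (x + y) / 2 + norm (x - y) / 2 - 1 \<in>
      {norm (x + y) / 2 + norm (x - y) / 2 - 1 | x y :: 'a. norm x = 1 \<and> norm y = \<tau>}"
    using assms by blast
  have "norm (x + y) / 2 + norm (x - y) / 2 - 1 \<le> \<tau>"
    if "norm x = 1" "norm y = \<tau>" for x y :: 'a
    using norm_triangle_ineq[of x y] norm_triangle_ineq4[of x y] that by simp
  then show "bdd_above
      {norm (x + y) / 2 + norm (x - y) / 2 - 1 | x y :: 'a. norm x = 1 \<and> norm y = \<tau>}"
    by (intro bdd_aboveI[of _ \<tau>]) auto
qed

lemma exists_norm_eq:
  assumes "\<exists>x::'a::real_normed_vector. x \<noteq> 0" "0 \<le> t"
  obtains z :: "'a::real_normed_vector" where "norm z = t"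
proof -
  from assms(1) obtain x :: 'a where "x \<noteq> 0" by blast
  then have "norm ((t / norm x) *\<^sub>R x) = t" using assms(2) by simp
  then show ?thesis by (rule that)
qed

lemma banas_modulus_least:
  assumes "\<exists>x::'a::real_normed_vector. x \<noteq> 0" "0 \<le> \<epsilon>"
    and "\<And>x y :: 'a. norm x = 1 \<Longrightarrow> norm y = 1 \<Longrightarrow> norm (x - y) \<le> \<epsilon> \<Longrightarrow>
      1 - norm (x + y) / 2 \<le> B"
  shows "banas_modulus TYPE('a) \<epsilon> \<le> B"
proof -
  obtain z :: 'a where "norm z = 1" using exists_norm_eq[OF assms(1), of 1] by auto
  then have "1 - norm (z + z) / 2 \<in> {1 - norm (x + y) / 2 | x y :: 'a.
      x \<in> sphere 0 1 \<and> y \<in> sphere 0 1 \<and> norm (x - y) \<le> \<epsilon>}"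
    using assms(2) by (intro CollectI exI[of _ z]) auto
  then show ?thesis
    unfolding banas_modulus_def using assms(3) by (intro cSup_least) auto
qed

lemma smoothness_modulus_least:
  assumes "\<exists>x::'a::real_normed_vector. x \<noteq> 0" "0 \<le> \<tau>"
    and "\<And>x y :: 'a. norm x = 1 \<Longrightarrow> norm y = \<tau> \<Longrightarrow>
      norm (x + y) / 2 + norm (x - y) / 2 - 1 \<le> B"
  shows "smoothness_modulus TYPE('a) \<tau> \<le> B"
proof -
  obtain x :: 'a where "norm x = 1" using exists_norm_eq[OF assms(1), of 1] by auto
  moreover obtain y :: 'a where "norm y = \<tau>" using exists_norm_eq[OF assms(1,2)] .
  ultimately have "norm (x + y) / 2 + norm (x - y) / 2 - 1 \<in>
      {norm (x + y) / 2 + norm (x - y) / 2 - 1 | x y :: 'a. norm x = 1 \<and> norm y = \<tau>}"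
    by blast
  then show ?thesis
    unfolding smoothness_modulus_def using assms(3) by (intro cSup_least) auto
qed

lemma banas_modulus_nonneg:
  assumes "\<exists>x::'a::real_normed_vector. x \<noteq> 0" "0 \<le> \<epsilon>"
  shows "0 \<le> banas_modulus TYPE('a) \<epsilon>"
proof -
  obtain x :: 'a where x: "norm x = 1" using exists_norm_eq[OF assms(1), of 1] by auto
  have "norm (x + x) = 2" using x by (simp flip: scaleR_2)
  then show ?thesis using banas_modulus_upper[of x x \<epsilon>] x assms(2) by simp
qed

lemma two_norm_le_norm_add_diff:
  fixes x y :: "'a::real_normed_vector"
  shows "2 * norm x \<le> norm (x + y) + norm (x - y)"
  using norm_triangle_ineq[of "x + y" "x - y"] by (simp flip: scaleR_2)

lemma smoothness_modulus_nonneg: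
  assumes "\<exists>x::'a::real_normed_vector. x \<noteq> 0" "0 \<le> \<tau>"
  shows "0 \<le> smoothness_modulus TYPE('a) \<tau>"
proof -
  obtain x :: 'a where x: "norm x = 1" using exists_norm_eq[OF assms(1), of 1] by auto
  obtain y :: 'a where y: "norm y = \<tau>" using exists_norm_eq[OF assms] .
  show ?thesis
    using smoothness_modulus_upper[OF x y] two_norm_le_norm_add_diff[of x y] x by simp
qed

section \<open>Banas modulus below the modulus of smoothness\<close>

text \<open>The function \<open>s \<mapsto> norm (x + s y) + norm (x - s y)\<close> is even and convex, hence it is nondecreasing
  in \<open>\<bar>s\<bar>\<close>.\<close>

lemma norm_add_diff_scaleR_le:
  fixes x y :: "'a::real_normed_vector"
  assumes "0 \<le> s" "s \<le> 1"
  shows "norm (x + s *\<^sub>R y) + norm (x - s *\<^sub>R y) \<le> norm (x + y) + norm (x - y)"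
proof -
  define p q where "p = (1 + s) / 2" and "q = (1 - s) / 2"
  have pq: "0 \<le> p" "0 \<le> q" "p + q = 1" "p - q = s"
    using assms by (auto simp: p_def q_def field_simps)
  have "p *\<^sub>R (x + y) + q *\<^sub>R (x - y) = (p + q) *\<^sub>R x + (p - q) *\<^sub>R y"
    and "q *\<^sub>R (x + y) + p *\<^sub>R (x - y) = (p + q) *\<^sub>R x - (p - q) *\<^sub>R y"
    by (simp_all add: algebra_simps)
  then have "x + s *\<^sub>R y = p *\<^sub>R (x + y) + q *\<^sub>R (x - y)"
    and "x - s *\<^sub>R y = q *\<^sub>R (x + y) + p *\<^sub>R (x - y)"
    by (simp_all add: pq)
  then have "norm (x + s *\<^sub>R y) \<le> p * norm (x + y) + q * norm (x - y)"
    and "norm (x - s *\<^sub>R y) \<le> q * norm (x + y) + p * norm (x - y)"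
    using norm_triangle_ineq[of "p *\<^sub>R (x + y)" "q *\<^sub>R (x - y)"]
      norm_triangle_ineq[of "q *\<^sub>R (x + y)" "p *\<^sub>R (x - y)"] pq by simp_all
  then have "norm (x + s *\<^sub>R y) + norm (x - s *\<^sub>R y)
      \<le> (p + q) * norm (x + y) + (p + q) * norm (x - y)"
    by (simp add: algebra_simps)
  then show ?thesis by (simp add: pq)
qed

lemma smoothness_modulus_upper_le:
  fixes x y :: "'a::real_normed_vector"
  assumes "norm x = 1" "norm y \<le> \<tau>"
  shows "norm (x + y) / 2 + norm (x - y) / 2 - 1 \<le> smoothness_modulus TYPE('a) \<tau>"
proof (cases "y = 0")
  case True
  have "\<exists>x::'a. x \<noteq> 0" using assms(1) by (intro exI[of _ x]) auto
  moreover have "0 \<le> \<tau>" using assms(2) norm_ge_zero[of y] by linarith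
  ultimately have "0 \<le> smoothness_modulus TYPE('a) \<tau>" by (rule smoothness_modulus_nonneg)
  then show ?thesis using True assms(1) by simp
next
  case False
  define z where "z = (\<tau> / norm y) *\<^sub>R y"
  have pos: "0 < norm y" "0 < \<tau>"
    using False assms(2) by (auto intro: less_le_trans[of 0 "norm y"])
  then have z: "norm z = \<tau>" "y = (norm y / \<tau>) *\<^sub>R z" by (simp_all add: z_def)
  have "norm (x + y) + norm (x - y) \<le> norm (x + z) + norm (x - z)"
    using norm_add_diff_scaleR_le[of "norm y / \<tau>" x z] pos assms(2) z(2) by simp
  then show ?thesis using smoothness_modulus_upper[OF assms(1) z(1)] by simp
qed

text \<open>Rescaling the midpoint of \<open>x\<close> and \<open>y\<close> to norm one turns the half difference into a balanced
  perturbation. Its size grows at most by the factor \<open>1 / (1 - r / 2)\<close>, which the factor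
  \<open>1 / 2\<close> in the half difference absorbs as long as \<open>r \<le> 1\<close>.\<close>

lemma banas_le_smoothness:
  assumes "\<exists>x::'a::real_normed_vector. x \<noteq> 0" "0 \<le> r" "r \<le> 1"
  shows "banas_modulus TYPE('a) r \<le> smoothness_modulus TYPE('a) r"
proof (rule banas_modulus_least[OF assms(1,2)])
  fix x y :: 'a
  assume x: "norm x = 1" and y: "norm y = 1" and xy: "norm (x - y) \<le> r"
  define k where "k = norm (x + y) / 2"
  define u v where "u = (1 / (2 * k)) *\<^sub>R (x + y)" and "v = (1 / (2 * k)) *\<^sub>R (x - y)"
  have "2 \<le> norm (x + y) + norm (x - y)" using two_norm_le_norm_add_diff[of x y] x by simp
  then have k: "1 / 2 \<le> k" using xy assms(3) by (simp add: k_def)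
  then have u: "norm u = 1" by (auto simp: u_def k_def)
  have "norm v = norm (x - y) / (2 * k)" using k by (simp add: v_def)
  also have "\<dots> \<le> norm (x - y)"
    using k by (simp add: divide_le_eq mult_le_cancel_left1)
  finally have v: "norm v \<le> r" using xy by simp
  have "u + v = (1 / (2 * k)) *\<^sub>R (2 *\<^sub>R x)" "u - v = (1 / (2 * k)) *\<^sub>R (2 *\<^sub>R y)"
    unfolding u_def v_def scaleR_2 by (simp_all flip: scaleR_add_right scaleR_diff_right)
  then have "norm (u + v) = 1 / k" "norm (u - v) = 1 / k" using x y k by simp_all
  then have "1 / k - 1 \<le> smoothness_modulus TYPE('a) r"
    using smoothness_modulus_upper_le[OF u v] by simp
  moreover have "1 - k \<le> 1 / k - 1"
  proof -
    have "0 \<le> (1 - k)\<^sup>2" by simp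
    then show ?thesis using k by (simp add: field_simps power2_eq_square)
  qed
  ultimately show "1 - norm (x + y) / 2 \<le> smoothness_modulus TYPE('a) r"
    by (simp add: k_def)
qed

section \<open>Modulus of smoothness below the modulus of Banas\<close>

text \<open>Moving \<open>c\<close> from \<open>- norm y\<close> to \<open>norm y\<close> shifts weight from one of the two norms to the other,
  so that their difference changes its sign.\<close>

lemma balanced_perturbation:
  fixes x y :: "'a::real_normed_vector"
  assumes "norm x = 1" "norm y \<le> 1"
  obtains c where "\<bar>c\<bar> \<le> norm y" "norm (x + (y - c *\<^sub>R x)) = norm (x - (y - c *\<^sub>R x))"
proof -
  define h where "h c = norm (x - (y - c *\<^sub>R x)) - norm (x + (y - c *\<^sub>R x))" for c
  define t where "t = norm y"
  have t: "0 \<le> t" "t \<le> 1" using assms(2) by (simp_all add: t_def)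
  have plus: "x + (y - c *\<^sub>R x) = (1 - c) *\<^sub>R x + y"
    and minus: "x - (y - c *\<^sub>R x) = (1 + c) *\<^sub>R x - y" for c
    by (simp_all add: algebra_simps)
  have small: "norm ((1 - t) *\<^sub>R x + y) \<le> 1" "norm ((1 - t) *\<^sub>R x - y) \<le> 1"
    using norm_triangle_ineq[of "(1 - t) *\<^sub>R x" y] norm_triangle_ineq4[of "(1 - t) *\<^sub>R x" y]
      assms(1) t by (simp_all add: t_def)
  have large: "1 \<le> norm ((1 + t) *\<^sub>R x - y)" "1 \<le> norm ((1 + t) *\<^sub>R x + y)"
    using norm_triangle_ineq2[of "(1 + t) *\<^sub>R x" y] norm_diff_ineq[of "(1 + t) *\<^sub>R x" y]
      assms(1) t by (simp_all add: t_def)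
  have "h (- t) = norm ((1 - t) *\<^sub>R x - y) - norm ((1 + t) *\<^sub>R x + y)"
    and "h t = norm ((1 + t) *\<^sub>R x - y) - norm ((1 - t) *\<^sub>R x + y)"
    unfolding h_def plus minus by simp_all
  then have "h (- t) \<le> 0" "0 \<le> h t" using small large by simp_all
  moreover have "continuous_on {- t..t} h" unfolding h_def by (intro continuous_intros)
  ultimately obtain c where "- t \<le> c" "c \<le> t" "h c = 0"
    using IVT'[of h "- t" 0 t] t by auto
  then show ?thesis by (intro that[of c]) (auto simp: h_def t_def)
qed

text \<open>After balancing \<open>Y = (3 / 2) y\<close> into \<open>w = Y - c x\<close>, with \<open>s = norm (x + w) = norm (x - w)\<close>,
  the vectors \<open>x + y\<close> and \<open>x - y\<close> are combinations of \<open>x\<close> and \<open>x + w\<close>, \<open>x - w\<close>. The weight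
  \<open>2 / 3\<close> falls on the balanced vectors and leaves weights \<open>1 / 3 + 2 c / 3\<close> and
  \<open>1 / 3 - 2 c / 3\<close> for \<open>x\<close>. Without the enlargement of \<open>y\<close> these would be \<open>c\<close> and \<open>- c\<close>, one
  of them negative, and the triangle inequality would lose a term of first order.\<close>

lemma smoothness_le_banas:
  assumes "\<exists>x::'a::real_normed_vector. x \<noteq> 0" "0 \<le> r" "r \<le> 2"
  shows "smoothness_modulus TYPE('a) (r / 6) \<le> 2 * banas_modulus TYPE('a) r"
proof (rule smoothness_modulus_least[OF assms(1)])
  show "0 \<le> r / 6" using assms(2) by simp
next
  fix x y :: 'a
  assume x: "norm x = 1" and y: "norm y = r / 6"
  define Y where "Y = (3 / 2) *\<^sub>R y"
  have Y: "norm Y = r / 4" using y by (simp add: Y_def)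
  then have "norm Y \<le> 1" using assms(3) by simp
  from balanced_perturbation[OF x this] obtain c
    where c: "\<bar>c\<bar> \<le> norm Y" and "norm (x + (Y - c *\<^sub>R x)) = norm (x - (Y - c *\<^sub>R x))" .
  define w s where "w = Y - c *\<^sub>R x" and "s = norm (x + w)"
  have s: "norm (x + w) = s" "norm (x - w) = s"
    using \<open>norm (x + (Y - c *\<^sub>R x)) = _\<close> by (simp_all add: w_def s_def)
  have w: "norm w \<le> r / 2"
    using norm_triangle_ineq4[of Y "c *\<^sub>R x"] c Y x by (simp add: w_def)
  have s1: "1 \<le> s" using two_norm_le_norm_add_diff[of x w] x s by simp
  have s2: "s \<le> 2" using norm_triangle_ineq[of x w] x w s(1) assms(3) by simp

  have "1 - 1 / s \<le> banas_modulus TYPE('a) r"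
  proof -
    have "(1 / s) *\<^sub>R (x + w) + (1 / s) *\<^sub>R (x - w) = (2 / s) *\<^sub>R x"
      and "(1 / s) *\<^sub>R (x + w) - (1 / s) *\<^sub>R (x - w) = (2 / s) *\<^sub>R w"
      by (simp_all add: algebra_simps flip: scaleR_add_left)
    moreover have "norm ((2 / s) *\<^sub>R w) \<le> r"
    proof -
      have "2 * norm w \<le> r * 1" using w by simp
      also have "\<dots> \<le> r * s" using s1 assms(2) by (intro mult_left_mono)
      finally show ?thesis using s1 by (simp add: divide_le_eq)
    qed
    ultimately show ?thesis
      using banas_modulus_upper[of "(1 / s) *\<^sub>R (x + w)" "(1 / s) *\<^sub>R (x - w)" r] s s1 x
      by simp
  qed
  moreover have "(s - 1) / 2 \<le> 1 - 1 / s"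
  proof -
    have "0 \<le> (s - 1) * (2 - s)" using s1 s2 by simp
    then show ?thesis using s1 by (simp add: field_simps)
  qed
  moreover have "norm (x + y) / 2 + norm (x - y) / 2 - 1 \<le> (2 / 3) * (s - 1)"
  proof -
    define a b where "a = 1 / 3 + (2 / 3) * c" and "b = 1 / 3 - (2 / 3) * c"
    have ab: "0 \<le> a" "0 \<le> b" "a + b = 2 / 3"
      using c Y assms(3) by (simp_all add: a_def b_def abs_le_iff)
    have "a *\<^sub>R x + (2 / 3) *\<^sub>R (x + w) = (a + 2 / 3 - (2 / 3) * c) *\<^sub>R x + y"
      and "b *\<^sub>R x + (2 / 3) *\<^sub>R (x - w) = (b + 2 / 3 + (2 / 3) * c) *\<^sub>R x - y"
      by (simp_all add: w_def Y_def algebra_simps)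
    then have "x + y = a *\<^sub>R x + (2 / 3) *\<^sub>R (x + w)" "x - y = b *\<^sub>R x + (2 / 3) *\<^sub>R (x - w)"
      by (simp_all add: a_def b_def)
    then have "norm (x + y) \<le> a + (2 / 3) * s" "norm (x - y) \<le> b + (2 / 3) * s"
      using norm_triangle_ineq[of "a *\<^sub>R x" "(2 / 3) *\<^sub>R (x + w)"]
        norm_triangle_ineq[of "b *\<^sub>R x" "(2 / 3) *\<^sub>R (x - w)"] ab x s by simp_all
    then show ?thesis using ab(3) by (simp add: field_simps)
  qed
  ultimately show "norm (x + y) / 2 + norm (x - y) / 2 - 1 \<le> 2 * banas_modulus TYPE('a) r"
    using s1 by argo
qed

section \<open>Equivalence at zero\<close>

theorem corollary1:
  assumes "\<exists>x::'a::banach. x \<noteq> 0"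
  shows "equiv_at_zero {0..2} (banas_modulus TYPE('a)) {0..} (smoothness_modulus TYPE('a)) \<and>
    (\<forall>r\<in>{0..1/2}.
       1/2 * smoothness_modulus TYPE('a) (r / 6) \<le> banas_modulus TYPE('a) r \<and>
       banas_modulus TYPE('a) r \<le> smoothness_modulus TYPE('a) r)"
proof
  have "\<forall>t\<in>{0..1/12}.
      1 * t \<in> {0..2} \<and> 6 * t \<in> {0..2} \<and> t \<in> {0..} \<and>
      1 * banas_modulus TYPE('a) (1 * t) \<le> smoothness_modulus TYPE('a) t \<and>
      smoothness_modulus TYPE('a) t \<le> 2 * banas_modulus TYPE('a) (6 * t)"
  proof
    fix t :: real
    assume "t \<in> {0..1/12}"
    then show "1 * t \<in> {0..2} \<and> 6 * t \<in> {0..2} \<and> t \<in> {0..} \<and>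
      1 * banas_modulus TYPE('a) (1 * t) \<le> smoothness_modulus TYPE('a) t \<and>
      smoothness_modulus TYPE('a) t \<le> 2 * banas_modulus TYPE('a) (6 * t)"
      using banas_le_smoothness[OF assms, of t] smoothness_le_banas[OF assms, of "6 * t"] by auto
  qed
  moreover have "(0::real) < 1" "(0::real) < 2" "(0::real) < 6" "(0::real) < 1 / 12" by simp_all
  ultimately have "\<exists>a>0. \<exists>b>0. \<exists>c>0. \<exists>d>0. \<exists>e>0. \<forall>t\<in>{0..e}.
      b * t \<in> {0..2} \<and> d * t \<in> {0..2} \<and> t \<in> {0..} \<and>
      a * banas_modulus TYPE('a) (b * t) \<le> smoothness_modulus TYPE('a) t \<and>
      smoothness_modulus TYPE('a) t \<le> c * banas_modulus TYPE('a) (d * t)"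
    by blast
  then show "equiv_at_zero {0..2} (banas_modulus TYPE('a)) {0..} (smoothness_modulus TYPE('a))"
    unfolding equiv_at_zero_def
    using banas_modulus_nonneg[OF assms] smoothness_modulus_nonneg[OF assms] by auto
  show "\<forall>r\<in>{0..1/2}.
      1/2 * smoothness_modulus TYPE('a) (r / 6) \<le> banas_modulus TYPE('a) r \<and>
      banas_modulus TYPE('a) r \<le> smoothness_modulus TYPE('a) r"
  proof
    fix r :: real
    assume "r \<in> {0..1/2}"
    then show "1/2 * smoothness_modulus TYPE('a) (r / 6) \<le> banas_modulus TYPE('a) r \<and>
        banas_modulus TYPE('a) r \<le> smoothness_modulus TYPE('a) r"
      using banas_le_smoothness[OF assms, of r] smoothness_le_banas[OF assms, of r] by auto
  qed
qed

end
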